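(* Let $d>0$ be the demand of a single strategic inelastic load. The optimization problem $$\min_{d^{DA}\ge 0,\ d^{RT}}\ \lambda^{DA}(d^{DA})\cdot d^{DA}+\lambda^{RT}(d^{DA},d^{RT})\cdot d^{RT}\quad\text{s.t.}\quad d^{DA}+d^{RT}=d$$ has a unique optimal solution, given by $$d^{DA*}=\left(1-\frac{\alpha^{DA}}{2\alpha^{RT}}\right)d,\qquad d^{RT*}=\frac{\alpha^{DA}}{2\alpha^{RT}}\,d ,$$ so that $d>d^{DA*}>\frac12 d>0$ and $\frac12 d>d^{RT*}>0$. Consequently, at this optimum $\lambda^{RT}>\lambda^{DA}$, i.e. the spread $\lambda^{DA}-\lambda^{RT}$ is strictly negative.
   Context: Let $\mathcal F$ (fast-responsive generators) and $\mathcal S$ (slow-responsive generators) be nonempty finite sets, with cost coefficients $\alpha_i^f>0,\ \beta_i^f\in\mathbb R$ for $i\in\mathcal F$ and $\alpha_j^s>0,\ \beta_j^s\in\mathbb R$ for $j\in\mathcal S$ (quadratic costs $\frac{\alpha}{2}x^2+\beta x$). Define $$\alpha^{DA}=\Big(\sum_{i\in\mathcal F}\tfrac1{\alpha_i^f}+\sum_{j\in\mathcal S}\tfrac1{\alpha_j^s}\Big)^{-1},\quad \beta^{DA}=\alpha^{DA}\Big(\sum_{i\in\mathcal F}\tfrac{\beta_i^f}{\alpha_i^f}+\sum_{j\in\mathcal S}\tfrac{\beta_j^s}{\alpha_j^s}\Big),\quad \alpha^{RT}=\Big(\sum_{i\in\mathcal F}\tfrac1{\alpha_i^f}\Big)^{-1}.$$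 In particular $\alpha^{RT}>\alpha^{DA}>0$. The market clearing prices, as functions of the load $d^{DA}$ cleared in the day-ahead market and the load $d^{RT}$ cleared in the real-time market, are $$\lambda^{DA}(d^{DA})=\alpha^{DA}d^{DA}+\beta^{DA},\qquad \lambda^{RT}(d^{DA},d^{RT})=\alpha^{RT}d^{RT}+\lambda^{DA}(d^{DA}).$$ (Generator nonnegativity constraints are assumed throughout not to be binding, so these price formulas hold.) *)

theory Defs
  imports Complex_Main
begin

text \<open>
  A generator with coefficients \<open>\<alpha>\<close>, \<open>\<beta>\<close> has cost \<open>\<alpha> / 2 * x\<^sup>2 + \<beta> * x\<close>.
  The prices below are the market clearing prices when no nonnegativity constraint of a generator
  binds. The two generator sets may live in different types, so no disjointness condition is needed.
\<close>

record ('f, 's) market =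
  fast :: "'f set"
  slow :: "'s set"
  alpha_f :: "'f \<Rightarrow> real"
  beta_f :: "'f \<Rightarrow> real"
  alpha_s :: "'s \<Rightarrow> real"
  beta_s :: "'s \<Rightarrow> real"

definition alpha_DA :: "('f, 's) market \<Rightarrow> real" where
  "alpha_DA M =
    inverse ((\<Sum>i\<in>fast M. 1 / alpha_f M i) + (\<Sum>j\<in>slow M. 1 / alpha_s M j))"

definition beta_DA :: "('f, 's) market \<Rightarrow> real" where
  "beta_DA M =
    alpha_DA M * ((\<Sum>i\<in>fast M. beta_f M i / alpha_f M i)
                  + (\<Sum>j\<in>slow M. beta_s M j / alpha_s M j))"

definition alpha_RT :: "('f, 's) market \<Rightarrow> real" where
  "alpha_RT M = inverse (\<Sum>i\<in>fast M. 1 / alpha_f M i)"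

definition price_DA :: "('f, 's) market \<Rightarrow> real \<Rightarrow> real" where
  "price_DA M x = alpha_DA M * x + beta_DA M"

definition price_RT :: "('f, 's) market \<Rightarrow> real \<Rightarrow> real \<Rightarrow> real" where
  "price_RT M x y = alpha_RT M * y + price_DA M x"

text \<open>
  A decision of the load is a pair of the day-ahead and the real-time quantity; the latter may have
  any sign.
\<close>

definition payment :: "('f, 's) market \<Rightarrow> real \<times> real \<Rightarrow> real" where
  "payment M = (\<lambda>(x, y). price_DA M x * x + price_RT M x y * y)"

definition feasible :: "real \<Rightarrow> real \<times> real \<Rightarrow> bool" where
  "feasible d = (\<lambda>(x, y). 0 \<le> x \<and> x + y = d)"

end

theory Submission
  imports Defs
begin

text \<open>
  On the line \<open>x + y = d\<close> the payment is a quadratic in \<open>y\<close> with leading coefficient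
  \<open>\<alpha>\<^sup>R\<^sup>T > 0\<close>; completing the square puts its vertex at \<open>y = \<alpha>\<^sup>D\<^sup>A d / (2 \<alpha>\<^sup>R\<^sup>T)\<close>. Since
  \<open>0 < \<alpha>\<^sup>D\<^sup>A < \<alpha>\<^sup>R\<^sup>T\<close>, the vertex satisfies \<open>0 < y < d / 2\<close>, so \<open>x \<ge> 0\<close> does not bind there.
\<close>

text \<open>Both coefficients are inverses of positive sums, and the slow generators add a strictly
  positive amount to the sum inside \<open>alpha_DA\<close>.\<close>

lemma alpha_DA_RT_bounds:
  assumes "finite (fast M)" and "fast M \<noteq> {}"
    and "finite (slow M)" and "slow M \<noteq> {}"
    and "\<And>i. i \<in> fast M \<Longrightarrow> alpha_f M i > 0"
    and "\<And>j. j \<in> slow M \<Longrightarrow> alpha_s M j > 0"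
  shows "0 < alpha_DA M" and "alpha_DA M < alpha_RT M"
proof -
  have f: "(\<Sum>i\<in>fast M. 1 / alpha_f M i) > 0"
    using assms by (intro sum_pos) auto
  have s: "(\<Sum>j\<in>slow M. 1 / alpha_s M j) > 0"
    using assms by (intro sum_pos) auto
  show "0 < alpha_DA M"
    unfolding alpha_DA_def using f s by simp
  show "alpha_DA M < alpha_RT M"
    unfolding alpha_DA_def alpha_RT_def using f s by (intro less_imp_inverse_less) auto
qed

text \<open>The day-ahead price is paid on both quantities, hence on all of \<open>d\<close>, and
  real time adds only \<open>alpha_RT M * y\<^sup>2\<close>. With \<open>x = d - y\<close> the
  linear term in \<open>y\<close> is \<open>- alpha_DA M * d * y\<close>, which fixes the
  vertex.\<close>

lemma payment_complete_square:
  assumes "alpha_RT M \<noteq> 0" and "x + y = d"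
  shows "payment M (x, y) =
    alpha_RT M * (y - alpha_DA M / (2 * alpha_RT M) * d)\<^sup>2
    + (alpha_DA M * d\<^sup>2 + beta_DA M * d - (alpha_DA M * d)\<^sup>2 / (4 * alpha_RT M))"
  using assms(1) unfolding assms(2)[symmetric]
  by (simp add: payment_def price_RT_def price_DA_def field_simps power2_eq_square)

theorem theorem2:
  fixes M :: "('f, 's) market" and d :: real
  assumes "finite (fast M)" and "fast M \<noteq> {}"
    and "finite (slow M)" and "slow M \<noteq> {}"
    and "\<And>i. i \<in> fast M \<Longrightarrow> alpha_f M i > 0"
    and "\<And>j. j \<in> slow M \<Longrightarrow> alpha_s M j > 0"
    and "d > 0"
  shows "let x = (1 - alpha_DA M / (2 * alpha_RT M)) * d;
             y = alpha_DA M / (2 * alpha_RT M) * d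
         in (\<forall>p. is_arg_min (payment M) (feasible d) p \<longleftrightarrow> p = (x, y))
            \<and> d > x \<and> x > d / 2 \<and> d / 2 > 0
            \<and> d / 2 > y \<and> y > 0
            \<and> price_RT M x y > price_DA M x
            \<and> price_DA M x - price_RT M x y < 0"
proof -
  define a where "a = alpha_DA M"
  define r where "r = alpha_RT M"
  define y where "y = a / (2 * r) * d"
  define x where "x = (1 - a / (2 * r)) * d"
  have "0 < a" and "a < r"
    using alpha_DA_RT_bounds[of M] assms(1-6) unfolding a_def r_def by blast+
  then have "0 < r" by simp
  have "0 < y"
    using \<open>0 < a\<close> \<open>0 < r\<close> \<open>d > 0\<close> by (simp add: y_def)
  have "y < d / 2"
    using \<open>a < r\<close> \<open>0 < r\<close> \<open>d > 0\<close> by (simp add: y_def field_simps)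
  have xy: "x + y = d"
    by (simp add: x_def y_def algebra_simps)
  define c where "c = a * d\<^sup>2 + beta_DA M * d - (a * d)\<^sup>2 / (4 * r)"
  have pay: "payment M (u, v) = r * (v - y)\<^sup>2 + c" if "feasible d (u, v)" for u v
    using payment_complete_square[of M u v d] \<open>0 < r\<close> that
    by (simp add: feasible_def a_def r_def y_def c_def)
  have feas: "feasible d (x, y)"
    using xy \<open>y < d / 2\<close> \<open>d > 0\<close> by (simp add: feasible_def)
  have min: "payment M (x, y) = c"
    using pay[OF feas] by simp
  have strict: "c < payment M p" if "feasible d p" and "p \<noteq> (x, y)" for p
  proof -
    obtain u v where p: "p = (u, v)" by fastforce
    \<comment> \<open>The sum constraint makes the real-time quantity determine the whole pair, so a
      different feasible pair has a positive square term.\<close>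
    have "v \<noteq> y"
      using that p xy by (auto simp: feasible_def)
    then show ?thesis
      using pay[of u v] that(1) p \<open>0 < r\<close> by simp
  qed
  \<comment> \<open>\<open>is_arg_min\<close> only excludes strictly smaller values; uniqueness
    comes from the strictness of \<open>strict\<close>.\<close>
  have "is_arg_min (payment M) (feasible d) p \<longleftrightarrow> p = (x, y)" for p
    unfolding is_arg_min_def using feas min strict by (metis less_asym less_irrefl)
  moreover have "price_RT M x y > price_DA M x"
    using \<open>0 < r\<close> \<open>0 < y\<close> by (simp add: price_RT_def r_def)
  \<comment> \<open>The bounds on \<open>x\<close> are those on \<open>y\<close> read through
    \<open>x = d - y\<close>.\<close>
  ultimately show ?thesis
    using \<open>0 < y\<close> \<open>y < d / 2\<close> xy \<open>d > 0\<close>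
    unfolding Let_def a_def[symmetric] r_def[symmetric] x_def[symmetric] y_def[symmetric]
    by auto
qed

end
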